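(* Let $d\in\{1,2,3\}$, let $a>0$, $h>0$, and consider the linear Schrödinger equation $i\,\partial_t\Psi+a\nabla^2\Psi=0$ (that is, $s=0$ and $V=0$) discretized in space on a $d$-dimensional grid with spacing $h$, with periodic, Dirichlet, or Laplacian-zero boundary conditions, giving the linear ODE system $\frac{d\vec\Psi}{dt}=\mathcal{A}\vec\Psi$ described in the context. Let $\mathbf{k}>0$ be the time step of the classical fourth-order Runge-Kutta (RK4) scheme. (1) If the spatial discretization is the second-order central difference (CD) scheme and $$\mathbf{k}<\frac{h^2}{d\,\sqrt{2}\,a},$$ then the RK4 scheme is stable. (2) If the spatial discretization is the fourth-order two-step high-order compact (2SHOC) scheme and $$\mathbf{k}<\left(\frac34\right)\frac{h^2}{d\,\sqrt{2}\,a},$$ then the RK4 scheme is stable.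
   Context: Stability. For a linear system $\frac{d\vec\Psi}{dt}=\mathcal{A}\vec\Psi$, the RK4 scheme with time step $\mathbf{k}>0$ is called stable if $|R(\mathbf{k}\lambda)|\le 1$ for every eigenvalue $\lambda\in\mathbb{C}$ of $\mathcal{A}$, where $R(p)=1+p+\frac{p^2}{2}+\frac{p^3}{6}+\frac{p^4}{24}$. Grid. The grid is $\prod_{m=1}^d\{0,1,\dots,N_m-1\}$ with all $N_m\ge 3$, with the same spacing $h$ in every direction; $e_m$ denotes the $m$-th unit vector. In the periodic case all indices are taken modulo $N_m$ in direction $m$ and there are no boundary points. In the Dirichlet and Laplacian-zero cases a boundary point is a grid point having some coordinate equal to $0$ or $N_m-1$; the other points are interior. Semi-discrete system. At each point $i$ (each interior point in the non-periodic cases), $\frac{d\Psi_i}{dt}=i_{\mathbb{C}}\,a\,(\Delta_h\Psi)_i$, where $i_{\mathbb{C}}$ is the imaginary unit and $\Delta_h$ is the discrete Laplacian below. At each boundary point $b$ in the Dirichlet ($\partial_t\Psi_b=0$) and Laplacian-zero ($\nabla^2\Psi_b=0$) cases, with $s=0$ and $V=0$, $\frac{d\Psi_b}{dt}=0$. Collecting all grid values into a vector $\vec\Psi$ gives $\frac{d\vec\Psi}{dt}=\mathcal{A}\vec\Psi$. CD scheme: $(\Delta_h\Psi)_i=\frac{1}{h^2}\sum_{m=1}^d(\Psi_{i+e_m}-2\Psi_i+\Psi_{i-e_m})$. 2SHOC scheme: first set $D_i=\frac{1}{h^2}\sum_{m=1}^d(\Psi_{i+e_m}-2\Psi_i+\Psi_{i-e_m})$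 at every point (every interior point in the non-periodic cases), and $D_b=0$ at every boundary point $b$ in the non-periodic cases (for $s=0$, $V=0$ the Laplacian at the boundary is zero for both boundary conditions). Then $$(\Delta_h\Psi)_i=\frac{16-2d}{12}D_i-\frac1{12}\sum_{m=1}^d(D_{i+e_m}+D_{i-e_m})+\frac{1}{6h^2}\sum_{1\le m<n\le d}\ \sum_{\sigma,\tau\in\{1,-1\}}(\Psi_{i+\sigma e_m+\tau e_n}-\Psi_i),$$ the last sum being empty for $d=1$. *)

theory Defs
  imports Complex_Main "Jordan_Normal_Form.Char_Poly"
begin

datatype boundary_condition = Periodic | Dirichlet | Laplacian_Zero

datatype scheme = CD | TwoSHOC

(* The list N holds the grid sizes, so the dimension is length N. A grid point is the list of its
   coordinates (counted from direction 0), and a grid function has type int list => complex; only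
   its values on the grid are relevant. *)

definition grid :: "nat list \<Rightarrow> int list list" where
  "grid N = product_lists (map (\<lambda>n. [0..int n - 1]) N)"

definition boundary_point :: "boundary_condition \<Rightarrow> nat list \<Rightarrow> int list \<Rightarrow> bool" where
  "boundary_point bc N i \<longleftrightarrow>
     bc \<noteq> Periodic \<and> (\<exists>m<length N. i ! m = 0 \<or> i ! m = int (N ! m) - 1)"

(* shift bc N m s i is i + s e_m, reduced modulo N_m in the periodic case. *)
definition shift :: "boundary_condition \<Rightarrow> nat list \<Rightarrow> nat \<Rightarrow> int \<Rightarrow> int list \<Rightarrow> int list" where
  "shift bc N m s i =
     i[m := (if bc = Periodic then (i ! m + s) mod int (N ! m) else i ! m + s)]"

definition central_diff ::
  "boundary_condition \<Rightarrow> nat list \<Rightarrow> real \<Rightarrow> (int list \<Rightarrow> complex) \<Rightarrow> int list \<Rightarrow> complex" where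
  "central_diff bc N h \<Psi> i =
     1 / (of_real h)\<^sup>2 *
       (\<Sum>m<length N. \<Psi> (shift bc N m 1 i) - 2 * \<Psi> i + \<Psi> (shift bc N m (-1) i))"

definition central_diff0 ::
  "boundary_condition \<Rightarrow> nat list \<Rightarrow> real \<Rightarrow> (int list \<Rightarrow> complex) \<Rightarrow> int list \<Rightarrow> complex" where
  "central_diff0 bc N h \<Psi> i = (if boundary_point bc N i then 0 else central_diff bc N h \<Psi> i)"

definition two_shoc ::
  "boundary_condition \<Rightarrow> nat list \<Rightarrow> real \<Rightarrow> (int list \<Rightarrow> complex) \<Rightarrow> int list \<Rightarrow> complex" where
  "two_shoc bc N h \<Psi> i =
     (let d = length N; D = central_diff0 bc N h \<Psi> in
       (16 - 2 * of_nat d) / 12 * D i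
       - 1 / 12 * (\<Sum>m<d. D (shift bc N m 1 i) + D (shift bc N m (-1) i))
       + 1 / (6 * (of_real h)\<^sup>2) *
           (\<Sum>m<d. \<Sum>n\<in>{m<..<d}. \<Sum>\<sigma>\<in>{1,-1}. \<Sum>\<tau>\<in>{1,-1}.
              \<Psi> (shift bc N m \<sigma> (shift bc N n \<tau> i)) - \<Psi> i))"

fun discrete_laplacian :: "scheme \<Rightarrow> boundary_condition \<Rightarrow> nat list \<Rightarrow> real \<Rightarrow>
    (int list \<Rightarrow> complex) \<Rightarrow> int list \<Rightarrow> complex" where
  "discrete_laplacian CD = central_diff"
| "discrete_laplacian TwoSHOC = two_shoc"

definition schroedinger_rhs :: "scheme \<Rightarrow> boundary_condition \<Rightarrow> nat list \<Rightarrow> real \<Rightarrow> real \<Rightarrow>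
    (int list \<Rightarrow> complex) \<Rightarrow> int list \<Rightarrow> complex" where
  "schroedinger_rhs S bc N h a \<Psi> i =
     (if boundary_point bc N i then 0
      else \<i> * of_real a * discrete_laplacian S bc N h \<Psi> i)"

definition grid_vec :: "nat list \<Rightarrow> (int list \<Rightarrow> complex) \<Rightarrow> complex vec" where
  "grid_vec N \<Psi> = vec (length (grid N)) (\<lambda>p. \<Psi> (grid N ! p))"

(* Column q is the right-hand side at the indicator of the q-th grid point; that this matrix
   represents the semi-discrete system is lemma schroedinger_matrix_mult_grid_vec below. *)
definition schroedinger_matrix ::
  "scheme \<Rightarrow> boundary_condition \<Rightarrow> nat list \<Rightarrow> real \<Rightarrow> real \<Rightarrow> complex mat" where
  "schroedinger_matrix S bc N h a =
     mat (length (grid N)) (length (grid N))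
       (\<lambda>(p, q). schroedinger_rhs S bc N h a
                  (\<lambda>j. if j = grid N ! q then 1 else 0) (grid N ! p))"

definition RK4_poly :: "complex \<Rightarrow> complex" where
  "RK4_poly p = 1 + p + p ^ 2 / 2 + p ^ 3 / 6 + p ^ 4 / 24"

definition RK4_stable :: "complex mat \<Rightarrow> real \<Rightarrow> bool" where
  "RK4_stable A k \<longleftrightarrow> (\<forall>\<mu>. eigenvalue A \<mu> \<longrightarrow> cmod (RK4_poly (of_real k * \<mu>)) \<le> 1)"

lemma set_grid:
  "i \<in> set (grid N) \<longleftrightarrow>
     length i = length N \<and> (\<forall>m<length N. 0 \<le> i ! m \<and> i ! m < int (N ! m))"
  by (auto simp: grid_def product_lists_set list_all2_conv_all_nth)

lemma distinct_grid: "distinct (grid N)"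
  unfolding grid_def by (rule distinct_product_lists) auto

lemma length_shift [simp]: "length (shift bc N m s i) = length i"
  by (simp add: shift_def)

lemma nth_shift:
  "m < length i \<Longrightarrow> shift bc N m s i ! n =
     (if n = m then (if bc = Periodic then (i ! m + s) mod int (N ! m) else i ! m + s) else i ! n)"
  by (auto simp: shift_def)

lemma shift_grid:
  assumes "i \<in> set (grid N)" "m < length N" "\<bar>s\<bar> \<le> 1"
    and "bc \<noteq> Periodic \<Longrightarrow> i ! m \<noteq> 0 \<and> i ! m \<noteq> int (N ! m) - 1"
  shows "shift bc N m s i \<in> set (grid N)"
proof -
  have i: "length i = length N" "\<And>m. m < length N \<Longrightarrow> 0 \<le> i ! m \<and> i ! m < int (N ! m)"
    using assms(1) by (auto simp: set_grid)
  show ?thesis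
    unfolding set_grid
  proof (intro conjI allI impI)
    fix n assume n: "n < length N"
    have "0 \<le> shift bc N m s i ! n \<and> shift bc N m s i ! n < int (N ! n)"
    proof (cases "n = m \<and> bc \<noteq> Periodic")
      case True
      then show ?thesis using i assms(2-4) by (force simp: nth_shift)
    next
      case False
      show ?thesis
      proof (cases "n = m")
        case True
        with False have "bc = Periodic" by simp
        moreover have "0 < int (N ! m)" using i(2)[OF assms(2)] by linarith
        ultimately show ?thesis using i(1) assms(2) True by (simp add: nth_shift)
      next
        case False
        then show ?thesis using i(1) i(2)[OF n] assms(2) by (simp add: nth_shift)
      qed
    qed
    then show "0 \<le> shift bc N m s i ! n" "shift bc N m s i ! n < int (N ! n)" by auto
  qed (use i in simp)
qed

lemma shift_grid_interior:
  assumes "i \<in> set (grid N)" "\<not> boundary_point bc N i" "m < length N" "\<bar>s\<bar> \<le> 1"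
  shows "shift bc N m s i \<in> set (grid N)"
  using assms by (intro shift_grid) (auto simp: boundary_point_def)

lemma shift_shift_grid_interior:
  assumes "i \<in> set (grid N)" "\<not> boundary_point bc N i" "m < length N" "\<bar>s\<bar> \<le> 1"
    and "n < length N" "\<bar>t\<bar> \<le> 1" "m \<noteq> n"
  shows "shift bc N m s (shift bc N n t i) \<in> set (grid N)"
proof (rule shift_grid)
  show "shift bc N n t i \<in> set (grid N)"
    using assms by (intro shift_grid_interior) auto
  have "length i = length N" using assms(1) by (simp add: set_grid)
  then show "shift bc N n t i ! m \<noteq> 0 \<and> shift bc N n t i ! m \<noteq> int (N ! m) - 1"
    if "bc \<noteq> Periodic"
    using assms that by (auto simp: boundary_point_def nth_shift)
qed (use assms in auto)

lemma central_diff0_cong: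
  assumes "\<And>j. j \<in> set (grid N) \<Longrightarrow> \<Psi> j = \<Phi> j" "i \<in> set (grid N)"
  shows "central_diff0 bc N h \<Psi> i = central_diff0 bc N h \<Phi> i"
proof (cases "boundary_point bc N i")
  case False
  then show ?thesis
    using assms by (simp add: central_diff0_def central_diff_def shift_grid_interior)
qed (simp add: central_diff0_def)

lemma schroedinger_rhs_cong:
  assumes eq: "\<And>j. j \<in> set (grid N) \<Longrightarrow> \<Psi> j = \<Phi> j" and i: "i \<in> set (grid N)"
  shows "schroedinger_rhs S bc N h a \<Psi> i = schroedinger_rhs S bc N h a \<Phi> i"
proof (cases "boundary_point bc N i")
  case False
  have D: "central_diff0 bc N h \<Psi> j = central_diff0 bc N h \<Phi> j" if "j \<in> set (grid N)" for j
    using eq that by (rule central_diff0_cong)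
  have "discrete_laplacian S bc N h \<Psi> i = discrete_laplacian S bc N h \<Phi> i"
  proof (cases S)
    case CD
    then show ?thesis using D[OF i] False by (simp add: central_diff0_def)
  next
    case TwoSHOC
    have sh: "shift bc N m s i \<in> set (grid N)" if "m < length N" "\<bar>s\<bar> \<le> 1" for m s
      using i False that by (rule shift_grid_interior)
    have sh2: "shift bc N m s (shift bc N n t i) \<in> set (grid N)"
      if "m < length N" "\<bar>s\<bar> \<le> 1" "n < length N" "\<bar>t\<bar> \<le> 1" "m \<noteq> n" for m s n t
      using i False that by (rule shift_shift_grid_interior)
    have "(\<Sum>m<length N. central_diff0 bc N h \<Psi> (shift bc N m 1 i)
             + central_diff0 bc N h \<Psi> (shift bc N m (-1) i))
        = (\<Sum>m<length N. central_diff0 bc N h \<Phi> (shift bc N m 1 i)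
             + central_diff0 bc N h \<Phi> (shift bc N m (-1) i))"
      by (intro sum.cong refl arg_cong2[of _ _ _ _ "(+)"] D sh) auto
    moreover have "(\<Sum>m<length N. \<Sum>n\<in>{m<..<length N}. \<Sum>\<sigma>\<in>{1,-1}. \<Sum>\<tau>\<in>{1,-1}.
              \<Psi> (shift bc N m \<sigma> (shift bc N n \<tau> i)) - \<Psi> i)
        = (\<Sum>m<length N. \<Sum>n\<in>{m<..<length N}. \<Sum>\<sigma>\<in>{1,-1}. \<Sum>\<tau>\<in>{1,-1}.
              \<Phi> (shift bc N m \<sigma> (shift bc N n \<tau> i)) - \<Phi> i)"
      by (intro sum.cong refl arg_cong2[of _ _ _ _ "(-)"] eq sh2 i) auto
    ultimately show ?thesis
      using TwoSHOC D[OF i] by (simp only: discrete_laplacian.simps two_shoc_def Let_def)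
  qed
  then show ?thesis by (simp add: schroedinger_rhs_def)
qed (simp add: schroedinger_rhs_def)

lemma central_diff0_add:
  "central_diff0 bc N h (\<lambda>j. \<Psi> j + \<Phi> j) i =
     central_diff0 bc N h \<Psi> i + central_diff0 bc N h \<Phi> i"
  by (simp add: central_diff0_def central_diff_def sum.distrib sum_subtractf algebra_simps
      flip: add_divide_distrib)

lemma central_diff0_scale:
  "central_diff0 bc N h (\<lambda>j. c * \<Psi> j) i = c * central_diff0 bc N h \<Psi> i"
  by (simp add: central_diff0_def central_diff_def sum_distrib_left algebra_simps)

lemma schroedinger_rhs_add:
  "schroedinger_rhs S bc N h a (\<lambda>j. \<Psi> j + \<Phi> j) i =
     schroedinger_rhs S bc N h a \<Psi> i + schroedinger_rhs S bc N h a \<Phi> i"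
proof (cases S)
  case CD
  then show ?thesis
    using central_diff0_add[of bc N h \<Psi> \<Phi> i]
    by (auto simp: schroedinger_rhs_def central_diff0_def simp flip: distrib_left)
next
  case TwoSHOC
  have "two_shoc bc N h (\<lambda>j. \<Psi> j + \<Phi> j) i = two_shoc bc N h \<Psi> i + two_shoc bc N h \<Phi> i"
    by (simp only: two_shoc_def Let_def central_diff0_add add_diff_add sum.distrib
        distrib_left add.assoc add.commute add.left_commute)
      (simp add: sum.distrib algebra_simps)
  with TwoSHOC show ?thesis
    by (simp add: schroedinger_rhs_def algebra_simps)
qed

lemma schroedinger_rhs_scale:
  "schroedinger_rhs S bc N h a (\<lambda>j. c * \<Psi> j) i = c * schroedinger_rhs S bc N h a \<Psi> i"
proof (cases S)
  case CD
  then show ?thesis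
    using central_diff0_scale[of bc N h c \<Psi> i]
    by (auto simp: schroedinger_rhs_def central_diff0_def)
next
  case TwoSHOC
  have "two_shoc bc N h (\<lambda>j. c * \<Psi> j) i = c * two_shoc bc N h \<Psi> i"
    by (simp only: two_shoc_def Let_def central_diff0_scale flip: distrib_left
        right_diff_distrib sum_distrib_left)
      (simp add: algebra_simps)
  with TwoSHOC show ?thesis
    by (simp add: schroedinger_rhs_def)
qed

lemma schroedinger_rhs_sum:
  assumes "finite P"
  shows "schroedinger_rhs S bc N h a (\<lambda>j. \<Sum>p\<in>P. c p * f p j) i =
           (\<Sum>p\<in>P. c p * schroedinger_rhs S bc N h a (f p) i)"
  using assms
proof (induction P rule: finite_induct)
  case empty
  show ?case using schroedinger_rhs_scale[of S bc N h a 0 "\<lambda>_. 0" i] by simp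
next
  case (insert p P)
  then show ?case by (simp add: schroedinger_rhs_add schroedinger_rhs_scale)
qed

lemma schroedinger_matrix_mult_grid_vec:
  "schroedinger_matrix S bc N h a *\<^sub>v grid_vec N \<Psi> =
     grid_vec N (schroedinger_rhs S bc N h a \<Psi>)"
proof (rule eq_vecI)
  let ?n = "length (grid N)"
  let ?\<delta> = "\<lambda>q j. if j = grid N ! q then 1 else 0 :: complex"
  show "dim_vec (schroedinger_matrix S bc N h a *\<^sub>v grid_vec N \<Psi>) =
      dim_vec (grid_vec N (schroedinger_rhs S bc N h a \<Psi>))"
    by (simp add: schroedinger_matrix_def grid_vec_def)
  fix p assume "p < dim_vec (grid_vec N (schroedinger_rhs S bc N h a \<Psi>))"
  then have p: "p < ?n" by (simp add: grid_vec_def)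
  have exp: "\<Psi> j = (\<Sum>q<?n. \<Psi> (grid N ! q) * ?\<delta> q j)" if j: "j \<in> set (grid N)" for j
  proof -
    obtain r where r: "r < ?n" "j = grid N ! r"
      using j by (metis in_set_conv_nth)
    have "(\<Sum>q<?n. \<Psi> (grid N ! q) * ?\<delta> q j) = (\<Sum>q<?n. if q = r then \<Psi> j else 0)"
      using r distinct_grid by (intro sum.cong) (auto simp: nth_eq_iff_index_eq)
    then show ?thesis using r by simp
  qed
  have "(schroedinger_matrix S bc N h a *\<^sub>v grid_vec N \<Psi>) $ p =
      (\<Sum>q<?n. \<Psi> (grid N ! q) * schroedinger_rhs S bc N h a (?\<delta> q) (grid N ! p))"
    using p by (simp add: schroedinger_matrix_def grid_vec_def scalar_prod_def mult.commute
        lessThan_atLeast0)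
  also have "\<dots> = schroedinger_rhs S bc N h a
      (\<lambda>j. \<Sum>q<?n. \<Psi> (grid N ! q) * ?\<delta> q j) (grid N ! p)"
    by (rule schroedinger_rhs_sum[symmetric]) simp
  also have "\<dots> = schroedinger_rhs S bc N h a \<Psi> (grid N ! p)"
    using p by (intro schroedinger_rhs_cong exp[symmetric]) auto
  also have "\<dots> = grid_vec N (schroedinger_rhs S bc N h a \<Psi>) $ p"
    using p by (simp add: grid_vec_def)
  finally show "(schroedinger_matrix S bc N h a *\<^sub>v grid_vec N \<Psi>) $ p =
      grid_vec N (schroedinger_rhs S bc N h a \<Psi>) $ p" .
qed

end

theory Submission
  imports Defs
begin

text \<open>Let \<open>S\<^sub>m\<close> map a grid function vanishing off the interior to the sum of its two neighbours
  in direction \<open>m\<close>. The \<open>S\<^sub>m\<close> commute, are Hermitian, and have sup-norm at most 2. The CD Laplacian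
  is \<open>\<Sum>\<^sub>m (S\<^sub>m - 2) / h\<^sup>2\<close>; in the 2SHOC Laplacian all mixed products \<open>S\<^sub>m S\<^sub>n\<close> cancel, leaving
  \<open>\<Sum>\<^sub>m (16 S\<^sub>m - 28 - S\<^sub>m\<^sup>2) / (12 h\<^sup>2)\<close>. Hence the eigenvalues are real, and bounded in
  modulus by \<open>4 d / h\<^sup>2\<close> and \<open>64 d / (12 h\<^sup>2)\<close> respectively, whereas RK4 is stable on the segment
  \<open>\<bar>Im p\<bar> \<le> 2 \<surd>2\<close> of the imaginary axis. An eigenvector of a non-zero eigenvalue vanishes on the
  boundary, so the boundary conditions need no separate treatment.\<close>

section \<open>Neighbour sums on functions supported in the interior\<close>

definition interior :: "boundary_condition \<Rightarrow> nat list \<Rightarrow> int list set" where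
  "interior bc N = {i \<in> set (grid N). \<not> boundary_point bc N i}"

text \<open>Truncating to zero off the interior keeps the functions supported there invariant, so
  these operators can be composed. It also matches the convention D_b = 0 of the 2SHOC
  scheme.\<close>

definition neighbour_sum ::
  "boundary_condition \<Rightarrow> nat list \<Rightarrow> nat \<Rightarrow> (int list \<Rightarrow> complex) \<Rightarrow> int list \<Rightarrow> complex" where
  "neighbour_sum bc N m \<Psi> i =
     (if i \<in> interior bc N then \<Psi> (shift bc N m 1 i) + \<Psi> (shift bc N m (-1) i) else 0)"

lemma finite_interior [simp]: "finite (interior bc N)"
  by (simp add: interior_def)

lemma neighbour_sum_outside: "i \<notin> interior bc N \<Longrightarrow> neighbour_sum bc N m \<Psi> i = 0"
  by (simp add: neighbour_sum_def)

lemma shift_shift_cancel: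
  assumes "i \<in> set (grid N)" "m < length N"
  shows "shift bc N m s (shift bc N m (- s) i) = i"
proof -
  have "length i = length N" "0 \<le> i ! m" "i ! m < int (N ! m)"
    using assms by (auto simp: set_grid)
  then show ?thesis
    using assms(2) by (auto simp: shift_def mod_simps list_update_same_conv)
qed

lemma shift_commute:
  assumes "m \<noteq> n"
  shows "shift bc N m s (shift bc N n t i) = shift bc N n t (shift bc N m s i)"
  using assms by (simp add: shift_def list_update_swap)

text \<open>Summation by parts. The shift by \<open>s\<close> is a bijection, with inverse the shift
  by \<open>- s\<close>, between the interior points that it keeps in the interior and those that
  \<open>- s\<close> keeps there; every other term contains a factor that vanishes.\<close>

lemma sum_shift_adjoint:
  fixes \<Phi> \<Psi> :: "int list \<Rightarrow> complex"
  assumes m: "m < length N"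
    and \<Phi>: "\<And>j. j \<notin> interior bc N \<Longrightarrow> \<Phi> j = 0"
    and \<Psi>: "\<And>j. j \<notin> interior bc N \<Longrightarrow> \<Psi> j = 0"
  shows "(\<Sum>i\<in>interior bc N. \<Phi> i * \<Psi> (shift bc N m s i)) =
         (\<Sum>i\<in>interior bc N. \<Phi> (shift bc N m (- s) i) * \<Psi> i)"
proof -
  let ?I = "interior bc N"
  let ?A = "\<lambda>s. {i \<in> ?I. shift bc N m s i \<in> ?I}"
  have "(\<Sum>i\<in>?I. \<Phi> i * \<Psi> (shift bc N m s i)) = (\<Sum>i\<in>?A s. \<Phi> i * \<Psi> (shift bc N m s i))"
    using \<Psi> by (intro sum.mono_neutral_right) auto
  also have "\<dots> = (\<Sum>i\<in>?A (- s). \<Phi> (shift bc N m (- s) i) * \<Psi> i)"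
    using shift_shift_cancel[OF _ m, of _ bc s] shift_shift_cancel[OF _ m, of _ bc "- s"]
    by (intro sum.reindex_bij_witness[of _ "shift bc N m (- s)" "shift bc N m s"])
      (auto simp: interior_def)
  also have "\<dots> = (\<Sum>i\<in>?I. \<Phi> (shift bc N m (- s) i) * \<Psi> i)"
    using \<Phi> by (intro sum.mono_neutral_left) auto
  finally show ?thesis .
qed

text \<open>The shifts by \<open>1\<close> and \<open>-1\<close> are adjoint to each other, so their
  sum is self-adjoint.\<close>

lemma neighbour_sum_hermitian:
  assumes m: "m < length N"
    and \<Phi>: "\<And>j. j \<notin> interior bc N \<Longrightarrow> \<Phi> j = 0"
    and \<Psi>: "\<And>j. j \<notin> interior bc N \<Longrightarrow> \<Psi> j = 0"
  shows "(\<Sum>i\<in>interior bc N. cnj (\<Phi> i) * neighbour_sum bc N m \<Psi> i) =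
         (\<Sum>i\<in>interior bc N. cnj (neighbour_sum bc N m \<Phi> i) * \<Psi> i)"
  using sum_shift_adjoint[of m N bc "\<lambda>i. cnj (\<Phi> i)" \<Psi> 1]
    sum_shift_adjoint[of m N bc "\<lambda>i. cnj (\<Phi> i)" \<Psi> "-1"] assms
  by (simp add: neighbour_sum_def algebra_simps sum.distrib)

lemma norm_neighbour_sum_le:
  assumes "\<And>j. cmod (\<Psi> j) \<le> M"
  shows "cmod (neighbour_sum bc N m \<Psi> i) \<le> 2 * M"
proof (cases "i \<in> interior bc N")
  case True
  then show ?thesis
    using norm_triangle_mono[OF assms assms] by (simp add: neighbour_sum_def)
next
  case False
  have "0 \<le> M" using norm_ge_zero assms by (rule order_trans)
  then show ?thesis using False by (simp add: neighbour_sum_outside)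
qed

section \<open>Spectrum of real quadratic polynomials in the neighbour sums\<close>

text \<open>Reality comes from the Rayleigh quotient of a Hermitian operator. The bound comes from
  reading the eigenvalue equation at a point where the modulus of \<open>\<Psi>\<close> is maximal:
  each direction contributes at most the sup-norm of its polynomial.\<close>

lemma eigenvalue_neighbour_polynomial:
  fixes \<alpha> \<beta> \<gamma> :: real
  assumes supp: "\<And>j. j \<notin> interior bc N \<Longrightarrow> \<Psi> j = 0"
    and nz: "\<Psi> j0 \<noteq> 0"
    and eig: "\<And>i. i \<in> interior bc N \<Longrightarrow>
      (\<Sum>m<length N. of_real \<alpha> * neighbour_sum bc N m \<Psi> i - of_real \<beta> * \<Psi> i
         - of_real \<gamma> * neighbour_sum bc N m (neighbour_sum bc N m \<Psi>) i) = \<nu> * \<Psi> i"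
  shows "\<nu> \<in> \<real>" and "cmod \<nu> \<le> real (length N) * (2 * \<bar>\<alpha>\<bar> + \<bar>\<beta>\<bar> + 4 * \<bar>\<gamma>\<bar>)"
proof -
  let ?I = "interior bc N"
  let ?S = "neighbour_sum bc N"
  define T where "T = (\<lambda>m i. of_real \<alpha> * ?S m \<Psi> i - of_real \<beta> * \<Psi> i - of_real \<gamma> * ?S m (?S m \<Psi>) i)"
  have j0: "j0 \<in> ?I" using supp nz by blast
  have T_eig: "(\<Sum>m<length N. T m i) = \<nu> * \<Psi> i" if "i \<in> ?I" for i
    using eig[OF that] by (simp add: T_def)
  have herm: "(\<Sum>i\<in>?I. cnj (\<Psi> i) * T m i) = (\<Sum>i\<in>?I. cnj (T m i) * \<Psi> i)" if m: "m < length N" for m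
  proof -
    note S = neighbour_sum_hermitian[OF m]
    have 1: "(\<Sum>i\<in>?I. cnj (\<Psi> i) * ?S m \<Psi> i) = (\<Sum>i\<in>?I. cnj (?S m \<Psi> i) * \<Psi> i)"
      using supp by (intro S)
    \<comment> \<open>The two factors of the square are moved across one at a time; this is
      legitimate because \<open>?S m \<Psi>\<close> again vanishes off the interior.\<close>
    have "(\<Sum>i\<in>?I. cnj (\<Psi> i) * ?S m (?S m \<Psi>) i) = (\<Sum>i\<in>?I. cnj (?S m \<Psi> i) * ?S m \<Psi> i)"
      using supp by (intro S) (simp_all add: neighbour_sum_outside)
    also have "\<dots> = (\<Sum>i\<in>?I. cnj (?S m (?S m \<Psi>) i) * \<Psi> i)"
      using supp by (intro S) (simp_all add: neighbour_sum_outside)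
    finally have 2: "(\<Sum>i\<in>?I. cnj (\<Psi> i) * ?S m (?S m \<Psi>) i) =
        (\<Sum>i\<in>?I. cnj (?S m (?S m \<Psi>) i) * \<Psi> i)" .
    have "(\<Sum>i\<in>?I. cnj (\<Psi> i) * T m i) = of_real \<alpha> * (\<Sum>i\<in>?I. cnj (\<Psi> i) * ?S m \<Psi> i)
        - of_real \<beta> * (\<Sum>i\<in>?I. cnj (\<Psi> i) * \<Psi> i)
        - of_real \<gamma> * (\<Sum>i\<in>?I. cnj (\<Psi> i) * ?S m (?S m \<Psi>) i)"
      by (simp add: T_def algebra_simps sum_subtractf sum.distrib sum_distrib_left)
    also have "\<dots> = (\<Sum>i\<in>?I. cnj (T m i) * \<Psi> i)"
      unfolding 1 2 by (simp add: T_def algebra_simps sum_subtractf sum.distrib sum_distrib_left)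
    finally show ?thesis .
  qed
  define P where "P = (\<Sum>i\<in>?I. (cmod (\<Psi> i))\<^sup>2)"
  have P: "P > 0"
    unfolding P_def using j0 nz by (intro sum_pos2[of _ j0]) auto
  have norm_sq: "complex_of_real ((cmod z)\<^sup>2) = cnj z * z" for z
    using complex_norm_square[of z] by (simp only: mult.commute)
  \<comment> \<open>Computing the quadratic form with the operator on the right and then on the left
    factor gives \<nu> P and its conjugate, where P > 0 is the squared norm of
    \<open>\<Psi>\<close>.\<close>
  have "\<nu> * of_real P = (\<Sum>i\<in>?I. cnj (\<Psi> i) * (\<Sum>m<length N. T m i))"
    unfolding P_def of_real_sum sum_distrib_left[of \<nu>]
    by (intro sum.cong refl) (simp only: T_eig norm_sq complex_cnj_mult mult_ac)
  also have "\<dots> = (\<Sum>m<length N. \<Sum>i\<in>?I. cnj (\<Psi> i) * T m i)"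
    unfolding sum_distrib_left by (rule sum.swap)
  also have "\<dots> = (\<Sum>m<length N. \<Sum>i\<in>?I. cnj (T m i) * \<Psi> i)"
    by (intro sum.cong refl herm) simp
  also have "\<dots> = (\<Sum>i\<in>?I. cnj (\<Sum>m<length N. T m i) * \<Psi> i)"
    unfolding cnj_sum sum_distrib_right by (rule sum.swap)
  also have "\<dots> = cnj \<nu> * of_real P"
    unfolding P_def of_real_sum sum_distrib_left[of "cnj \<nu>"]
    by (intro sum.cong refl) (simp only: T_eig norm_sq complex_cnj_mult mult_ac)
  finally have "\<nu> = cnj \<nu>" using P by simp
  then show "\<nu> \<in> \<real>" by (simp add: Reals_cnj_iff)

  define M where "M = Max ((\<lambda>i. cmod (\<Psi> i)) ` ?I)"
  have "M \<in> (\<lambda>i. cmod (\<Psi> i)) ` ?I"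
    unfolding M_def using j0 by (intro Max_in) auto
  then obtain i where i: "i \<in> ?I" "cmod (\<Psi> i) = M" by auto
  have M_ge: "cmod (\<Psi> j) \<le> M" if "j \<in> ?I" for j
    unfolding M_def using that by simp
  have M: "M > 0" using M_ge[OF j0] nz by (metis order_less_le_trans zero_less_norm_iff)
  \<comment> \<open>Neighbours of an interior point may be boundary points, so the maximum over the
    interior has to bound \<open>\<Psi>\<close> everywhere.\<close>
  have le0: "cmod (\<Psi> j) \<le> M" for j
    using M_ge[of j] supp[of j] M by (cases "j \<in> ?I") auto
  have T_le: "cmod (T m i) \<le> (2 * \<bar>\<alpha>\<bar> + \<bar>\<beta>\<bar> + 4 * \<bar>\<gamma>\<bar>) * M" for m
  proof -
    have le1: "cmod (?S m \<Psi> j) \<le> 2 * M" for j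
      using le0 by (rule norm_neighbour_sum_le)
    have le2: "cmod (?S m (?S m \<Psi>) i) \<le> 2 * (2 * M)"
      using le1 by (rule norm_neighbour_sum_le)
    have "cmod (T m i) \<le> cmod (of_real \<alpha> * ?S m \<Psi> i) + cmod (of_real \<beta> * \<Psi> i)
        + cmod (of_real \<gamma> * ?S m (?S m \<Psi>) i)"
      unfolding T_def by (meson norm_triangle_ineq4 order_trans add_right_mono)
    also have "\<dots> \<le> \<bar>\<alpha>\<bar> * (2 * M) + \<bar>\<beta>\<bar> * M + \<bar>\<gamma>\<bar> * (2 * (2 * M))"
      unfolding norm_mult norm_of_real
      by (intro add_mono mult_left_mono le0 le1 le2) auto
    finally show ?thesis by (simp add: algebra_simps)
  qed
  have "cmod \<nu> * M = cmod (\<Sum>m<length N. T m i)"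
    using i by (simp add: T_eig norm_mult)
  also have "\<dots> \<le> real (length N) * ((2 * \<bar>\<alpha>\<bar> + \<bar>\<beta>\<bar> + 4 * \<bar>\<gamma>\<bar>) * M)"
    using sum_norm_bound[of "{..<length N}" "\<lambda>m. T m i"] T_le by simp
  finally have "cmod \<nu> * M \<le> real (length N) * (2 * \<bar>\<alpha>\<bar> + \<bar>\<beta>\<bar> + 4 * \<bar>\<gamma>\<bar>) * M"
    by (simp add: mult.assoc)
  then show "cmod \<nu> \<le> real (length N) * (2 * \<bar>\<alpha>\<bar> + \<bar>\<beta>\<bar> + 4 * \<bar>\<gamma>\<bar>)"
    using M by simp
qed

section \<open>The discrete Laplacians as polynomials in the neighbour sums\<close>

text \<open>At a boundary point both sides are zero. The formula is thus available at all neighbours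
  of an interior point, where the second step of 2SHOC evaluates D.\<close>

lemma central_diff0_neighbour_sum:
  assumes "j \<in> set (grid N)" and supp: "\<And>j. j \<notin> interior bc N \<Longrightarrow> \<Psi> j = 0"
  shows "central_diff0 bc N h \<Psi> j =
    1 / (of_real h)\<^sup>2 * ((\<Sum>m<length N. neighbour_sum bc N m \<Psi> j) - 2 * of_nat (length N) * \<Psi> j)"
proof (cases "j \<in> interior bc N")
  case True
  then show ?thesis
    by (simp add: central_diff0_def central_diff_def interior_def neighbour_sum_def
        sum.distrib sum_subtractf algebra_simps)
next
  case False
  then show ?thesis
    using assms by (simp add: central_diff0_def interior_def neighbour_sum_def)
qed

text \<open>Truncating the inner sum loses nothing when m and n differ: if a step in direction n
  reaches the boundary, a further step in direction m stays on it or leaves the grid, and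
  \<open>\<Psi>\<close> vanishes there. For m = n the second step could return to the
  interior.\<close>

lemma neighbour_sum_neighbour_sum:
  assumes i: "i \<in> interior bc N" and m: "m < length N" and n: "n < length N" and "m \<noteq> n"
    and supp: "\<And>j. j \<notin> interior bc N \<Longrightarrow> \<Psi> j = 0"
  shows "neighbour_sum bc N n (neighbour_sum bc N m \<Psi>) i =
    (\<Sum>\<sigma>\<in>{1,-1}. \<Sum>\<tau>\<in>{1,-1}. \<Psi> (shift bc N m \<sigma> (shift bc N n \<tau> i)))"
proof -
  have *: "neighbour_sum bc N m \<Psi> (shift bc N n \<tau> i) =
      (\<Sum>\<sigma>\<in>{1,-1}. \<Psi> (shift bc N m \<sigma> (shift bc N n \<tau> i)))" if \<tau>: "\<bar>\<tau>\<bar> \<le> 1" for \<tau>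
  proof (cases "shift bc N n \<tau> i \<in> interior bc N")
    case True
    then show ?thesis by (simp add: neighbour_sum_def)
  next
    case False
    have len: "length i = length N"
      using i by (simp add: interior_def set_grid)
    have grid: "shift bc N n \<tau> i \<in> set (grid N)"
      using i n \<tau> by (auto simp: interior_def intro: shift_grid_interior)
    have "boundary_point bc N (shift bc N n \<tau> i)"
      using False grid by (simp add: interior_def)
    \<comment> \<open>Only coordinate n has changed and i was interior, so the point is on the
      boundary because of coordinate n, which a move in direction m preserves.\<close>
    then have "bc \<noteq> Periodic"
      and bd: "shift bc N n \<tau> i ! n = 0 \<or> shift bc N n \<tau> i ! n = int (N ! n) - 1"
      using i n len by (auto simp: boundary_point_def interior_def nth_shift split: if_splits)
    have "shift bc N m \<sigma> (shift bc N n \<tau> i) \<notin> interior bc N" for \<sigma>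
    proof -
      have "shift bc N m \<sigma> (shift bc N n \<tau> i) ! n = shift bc N n \<tau> i ! n"
        using m len \<open>m \<noteq> n\<close> by (simp add: nth_shift)
      then show ?thesis
        using bd n \<open>bc \<noteq> Periodic\<close> by (auto simp: interior_def boundary_point_def)
    qed
    then show ?thesis using False by (simp add: neighbour_sum_def supp)
  qed
  show ?thesis
    using i *[of 1] *[of "-1"] by (simp add: neighbour_sum_def[of bc N n])
qed

lemma neighbour_sum_commute:
  assumes "i \<in> interior bc N" "m < length N" "n < length N"
    and "\<And>j. j \<notin> interior bc N \<Longrightarrow> \<Psi> j = 0"
  shows "neighbour_sum bc N n (neighbour_sum bc N m \<Psi>) i =
         neighbour_sum bc N m (neighbour_sum bc N n \<Psi>) i"
proof (cases "m = n")
  case False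
  then show ?thesis
    using assms by (simp add: neighbour_sum_neighbour_sum shift_commute[of m n])
qed simp

text \<open>Splits the composition of D with the neighbour sums into squares and mixed products, the
  latter over m < n as in the diagonal stencil of 2SHOC. With constant \<open>X\<close> it counts
  the pairs m < n.\<close>

lemma sum_symmetric_square:
  fixes X :: "nat \<Rightarrow> nat \<Rightarrow> 'a :: comm_ring_1"
  assumes "\<And>m n. m < d \<Longrightarrow> n < d \<Longrightarrow> X m n = X n m"
  shows "(\<Sum>m<d. \<Sum>n<d. X m n) = (\<Sum>m<d. X m m) + 2 * (\<Sum>m<d. \<Sum>n\<in>{m<..<d}. X m n)"
  using assms
proof (induction d)
  case (Suc d)
  have gt: "{m<..<Suc d} = insert d {m<..<d}" if "m < d" for m
    using that by auto
  have empty: "{d<..<Suc d} = {}" by auto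
  have "(\<Sum>m<Suc d. \<Sum>n\<in>{m<..<Suc d}. X m n) = (\<Sum>m<d. (\<Sum>n\<in>{m<..<d}. X m n) + X m d)"
    by (simp add: gt empty add.commute)
  moreover have "(\<Sum>n<d. X d n) = (\<Sum>n<d. X n d)"
    using Suc.prems by (intro sum.cong) auto
  ultimately show ?case
    using Suc by (simp add: sum.distrib algebra_simps)
qed simp

text \<open>Applying the neighbour sums to D produces each mixed product twice, with weight -1/12
  each; the diagonal stencil supplies it once with weight 1/6. They cancel, and only one-directional
  operators remain.\<close>

lemma two_shoc_neighbour_sum:
  assumes i: "i \<in> interior bc N" and supp: "\<And>j. j \<notin> interior bc N \<Longrightarrow> \<Psi> j = 0"
  shows "two_shoc bc N h \<Psi> i = 1 / (12 * (of_real h)\<^sup>2) *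
    (\<Sum>m<length N. 16 * neighbour_sum bc N m \<Psi> i - 28 * \<Psi> i
       - neighbour_sum bc N m (neighbour_sum bc N m \<Psi>) i)"
proof -
  let ?S = "neighbour_sum bc N"
  let ?D = "central_diff0 bc N h \<Psi>"
  define d where "d = length N"
  define H :: complex where "H = 1 / (of_real h)\<^sup>2"
  define s where "s = (\<Sum>m<d. ?S m \<Psi> i)"
  define q where "q = (\<Sum>m<d. ?S m (?S m \<Psi>) i)"
  define c where "c = (\<Sum>m<d. \<Sum>n\<in>{m<..<d}. ?S n (?S m \<Psi>) i)"
  have ig: "i \<in> set (grid N)" "\<not> boundary_point bc N i"
    using i by (auto simp: interior_def)
  have "?D (shift bc N m 1 i) + ?D (shift bc N m (-1) i) =
      H * ((\<Sum>n<d. ?S m (?S n \<Psi>) i) - 2 * of_nat d * ?S m \<Psi> i)" if "m < d" for m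
  proof -
    have "shift bc N m 1 i \<in> set (grid N)" "shift bc N m (-1) i \<in> set (grid N)"
      using that ig by (auto simp: d_def intro: shift_grid_interior)
    then show ?thesis
      using i by (simp add: central_diff0_neighbour_sum[OF _ supp] neighbour_sum_def[of bc N m]
          H_def sum.distrib add_divide_distrib diff_divide_distrib algebra_simps flip: d_def)
  qed
  then have "(\<Sum>m<d. ?D (shift bc N m 1 i) + ?D (shift bc N m (-1) i)) =
      (\<Sum>m<d. H * ((\<Sum>n<d. ?S m (?S n \<Psi>) i) - 2 * of_nat d * ?S m \<Psi> i))"
    by (intro sum.cong) auto
  also have "\<dots> = H * ((\<Sum>m<d. \<Sum>n<d. ?S m (?S n \<Psi>) i) - 2 * of_nat d * s)"
    by (simp only: s_def right_diff_distrib sum_subtractf sum_distrib_left)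
  also have "(\<Sum>m<d. \<Sum>n<d. ?S m (?S n \<Psi>) i) = q + 2 * (\<Sum>m<d. \<Sum>n\<in>{m<..<d}. ?S m (?S n \<Psi>) i)"
    unfolding q_def using i supp
    by (intro sum_symmetric_square neighbour_sum_commute) (auto simp: d_def)
  also have "(\<Sum>m<d. \<Sum>n\<in>{m<..<d}. ?S m (?S n \<Psi>) i) = c"
    unfolding c_def using i supp
    by (intro sum.cong refl neighbour_sum_commute) (auto simp: d_def)
  finally have DD: "(\<Sum>m<d. ?D (shift bc N m 1 i) + ?D (shift bc N m (-1) i)) =
      H * (q + 2 * c - 2 * of_nat d * s)" .
  have "(\<Sum>m<d. \<Sum>n\<in>{m<..<d}. \<Sum>\<sigma>\<in>{1,-1}. \<Sum>\<tau>\<in>{1,-1}.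
            \<Psi> (shift bc N m \<sigma> (shift bc N n \<tau> i)) - \<Psi> i)
      = (\<Sum>m<d. \<Sum>n\<in>{m<..<d}. ?S n (?S m \<Psi>) i - 4 * \<Psi> i)"
    using i supp by (intro sum.cong refl) (simp add: neighbour_sum_neighbour_sum d_def)
  also have "\<dots> = c - 2 * (of_nat d * of_nat d - of_nat d) * \<Psi> i"
  proof -
    \<comment> \<open>There are d (d - 1) / 2 pairs. Writing 4 as 2 * 2 matches the factor 2 in
      \<open>sum_symmetric_square\<close> and avoids halving.\<close>
    have "2 * (\<Sum>m<d. \<Sum>n\<in>{m<..<d}. 2 * \<Psi> i) = 2 * (of_nat d * of_nat d - of_nat d) * \<Psi> i"
      using sum_symmetric_square[of d "\<lambda>_ _. 2 * \<Psi> i"] by (simp add: algebra_simps)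
    moreover have "2 * (\<Sum>m<d. \<Sum>n\<in>{m<..<d}. 2 * \<Psi> i) = (\<Sum>m<d. \<Sum>n\<in>{m<..<d}. 4 * \<Psi> i)"
      unfolding sum_distrib_left by (simp add: mult.assoc)
    ultimately show ?thesis
      by (simp only: c_def sum_subtractf)
  qed
  finally have cross: "(\<Sum>m<d. \<Sum>n\<in>{m<..<d}. \<Sum>\<sigma>\<in>{1,-1}. \<Sum>\<tau>\<in>{1,-1}.
        \<Psi> (shift bc N m \<sigma> (shift bc N n \<tau> i)) - \<Psi> i)
      = c - 2 * (of_nat d * of_nat d - of_nat d) * \<Psi> i" .
  have D: "?D i = H * (s - 2 * of_nat d * \<Psi> i)"
    using central_diff0_neighbour_sum[OF ig(1) supp] by (simp add: H_def s_def d_def)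
  have H6: "1 / (6 * (of_real h)\<^sup>2) = H / 6" and H12: "1 / (12 * (of_real h)\<^sup>2) = H / 12"
    by (simp_all add: H_def)
  have "two_shoc bc N h \<Psi> i = (16 - 2 * of_nat d) / 12 * (H * (s - 2 * of_nat d * \<Psi> i))
      - 1 / 12 * (H * (q + 2 * c - 2 * of_nat d * s))
      + H / 6 * (c - 2 * (of_nat d * of_nat d - of_nat d) * \<Psi> i)"
    unfolding two_shoc_def Let_def d_def[symmetric] DD cross D H6 ..
  \<comment> \<open>Besides \<open>c\<close>, the terms d \<open>s\<close> and d^2
    \<open>\<Psi> i\<close> cancel; the coefficient of \<open>\<Psi> i\<close> becomes (-32 d + 4
    d^2 - 4 d^2 + 4 d) / 12 = -28 d / 12.\<close>
  also have "\<dots> = H / 12 * (16 * s - 28 * of_nat d * \<Psi> i - q)"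
    by (simp add: field_simps)
  also have "\<dots> = H / 12 * (\<Sum>m<d. 16 * ?S m \<Psi> i - 28 * \<Psi> i - ?S m (?S m \<Psi>) i)"
    by (simp add: s_def q_def sum_subtractf sum_distrib_left)
  finally show ?thesis
    unfolding H12 d_def .
qed

section \<open>From eigenvectors of the matrix to grid functions\<close>

lemma eigenvalue_schroedinger_matrixE:
  assumes "eigenvalue (schroedinger_matrix S bc N h a) \<mu>" and "\<mu> \<noteq> 0"
  obtains \<Psi> j0 where "\<And>j. j \<notin> interior bc N \<Longrightarrow> \<Psi> j = 0" and "\<Psi> j0 \<noteq> 0"
    and "\<And>i. i \<in> interior bc N \<Longrightarrow>
      \<i> * of_real a * discrete_laplacian S bc N h \<Psi> i = \<mu> * \<Psi> i"
proof -
  let ?n = "length (grid N)"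
  have "dim_row (schroedinger_matrix S bc N h a) = ?n"
    by (simp add: schroedinger_matrix_def)
  then obtain v where v: "dim_vec v = ?n" "v \<noteq> 0\<^sub>v ?n"
    and Av: "schroedinger_matrix S bc N h a *\<^sub>v v = \<mu> \<cdot>\<^sub>v v"
    using assms(1) unfolding eigenvalue_def eigenvector_def by (metis carrier_vecD)
  \<comment> \<open>Positions in \<open>grid N\<close> are unique, so the inverse of indexing
    recovers the component of \<open>v\<close>. The default 0 off the grid provides the part of the
    support condition that the eigenvalue equation does not reach.\<close>
  define \<Psi> where
    "\<Psi> = (\<lambda>j. if j \<in> set (grid N) then v $ inv_into {..<?n} ((!) (grid N)) j else 0)"
  have \<Psi>_nth: "\<Psi> (grid N ! p) = v $ p" if "p < ?n" for p
    using that by (simp add: \<Psi>_def inj_on_nth distinct_grid)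
  then have "v = grid_vec N \<Psi>"
    using v(1) by (auto simp: grid_vec_def)
  then have eq: "grid_vec N (schroedinger_rhs S bc N h a \<Psi>) = \<mu> \<cdot>\<^sub>v grid_vec N \<Psi>"
    using Av by (simp add: schroedinger_matrix_mult_grid_vec)
  have rhs: "schroedinger_rhs S bc N h a \<Psi> i = \<mu> * \<Psi> i" if i: "i \<in> set (grid N)" for i
  proof -
    obtain p where p: "p < ?n" "i = grid N ! p"
      using i by (auto simp: in_set_conv_nth)
    have "grid_vec N (schroedinger_rhs S bc N h a \<Psi>) $ p = \<mu> * grid_vec N \<Psi> $ p"
      unfolding eq using p(1) by (intro index_smult_vec) (simp add: grid_vec_def)
    then show ?thesis
      using p by (simp only: grid_vec_def index_vec)
  qed
  obtain p where p: "p < ?n" "v $ p \<noteq> 0"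
    using v by (metis eq_vecI index_zero_vec)
  show ?thesis
  proof
    fix j assume "j \<notin> interior bc N"
    then consider "j \<notin> set (grid N)" | "j \<in> set (grid N)" "boundary_point bc N j"
      by (auto simp: interior_def)
    then show "\<Psi> j = 0"
    proof cases
      case 1
      then show ?thesis by (simp add: \<Psi>_def)
    next
      case 2
      \<comment> \<open>A boundary row of the system is zero, so the equation reads 0 = \<mu>
        \<open>\<Psi> j\<close>.\<close>
      then show ?thesis using rhs[of j] \<open>\<mu> \<noteq> 0\<close> by (simp add: schroedinger_rhs_def)
    qed
  next
    show "\<Psi> (grid N ! p) \<noteq> 0" using p \<Psi>_nth by simp
  next
    fix i assume "i \<in> interior bc N"
    then show "\<i> * of_real a * discrete_laplacian S bc N h \<Psi> i = \<mu> * \<Psi> i"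
      using rhs[of i] by (simp add: interior_def schroedinger_rhs_def)
  qed
qed

section \<open>RK4 on the imaginary axis and the resulting stability criterion\<close>

text \<open>In the squared modulus the terms in y^2 and y^4 cancel, leaving 1 - y^6 (8 - y^2) /
  576.\<close>

lemma norm_RK4_poly_imaginary:
  assumes "y\<^sup>2 \<le> 8"
  shows "cmod (RK4_poly (\<i> * of_real y)) \<le> 1"
proof -
  have "RK4_poly (\<i> * of_real y) = Complex (1 - y ^ 2 / 2 + y ^ 4 / 24) (y - y ^ 3 / 6)"
    by (simp add: RK4_poly_def complex_eq_iff power2_eq_square power3_eq_cube power4_eq_xxxx)
  then have "(cmod (RK4_poly (\<i> * of_real y)))\<^sup>2 = (1 - y ^ 2 / 2 + y ^ 4 / 24)\<^sup>2 + (y - y ^ 3 / 6)\<^sup>2"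
    by (simp add: cmod_power2)
  also have "\<dots> = 1 - (y\<^sup>2) ^ 3 * (8 - y\<^sup>2) / 576"
    by (simp add: field_simps eval_nat_numeral)
  also have "\<dots> \<le> 1"
    using assms by simp
  finally show ?thesis
    by (simp add: power_le_one_iff)
qed

text \<open>Common criterion for both schemes: \<open>k\<close> times a non-zero eigenvalue is \<i>
  y with y real, and the last hypothesis is the spectral bound turned into \<bar>y\<bar> \<le> 2
  \<open>sqrt 2\<close>.\<close>

lemma RK4_stable_schroedinger_matrix:
  fixes \<alpha> \<beta> \<gamma> :: real
  assumes lap: "\<And>\<Psi> i. (\<And>j. j \<notin> interior bc N \<Longrightarrow> \<Psi> j = 0) \<Longrightarrow> i \<in> interior bc N \<Longrightarrow>
      discrete_laplacian S bc N h \<Psi> i = 1 / (of_real h)\<^sup>2 *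
        (\<Sum>m<length N. of_real \<alpha> * neighbour_sum bc N m \<Psi> i - of_real \<beta> * \<Psi> i
           - of_real \<gamma> * neighbour_sum bc N m (neighbour_sum bc N m \<Psi>) i)"
    and "a > 0" "h > 0" "k > 0"
    and k: "k * a * (real (length N) * (2 * \<bar>\<alpha>\<bar> + \<bar>\<beta>\<bar> + 4 * \<bar>\<gamma>\<bar>)) \<le> 2 * sqrt 2 * h\<^sup>2"
  shows "RK4_stable (schroedinger_matrix S bc N h a) k"
  unfolding RK4_stable_def
proof (intro allI impI)
  fix \<mu> assume ev: "eigenvalue (schroedinger_matrix S bc N h a) \<mu>"
  show "cmod (RK4_poly (of_real k * \<mu>)) \<le> 1"
  proof (cases "\<mu> = 0")
    \<comment> \<open>The eigenvalue 0 is harmless since R(0) = 1; it is split off because its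
      eigenvectors may be non-zero on the boundary.\<close>
    case True
    then show ?thesis by (simp add: RK4_poly_def)
  next
    case False
    obtain \<Psi> j0 where supp: "\<And>j. j \<notin> interior bc N \<Longrightarrow> \<Psi> j = 0" and nz: "\<Psi> j0 \<noteq> 0"
      and eig: "\<And>i. i \<in> interior bc N \<Longrightarrow>
        \<i> * of_real a * discrete_laplacian S bc N h \<Psi> i = \<mu> * \<Psi> i"
      using eigenvalue_schroedinger_matrixE[OF ev False] by metis
    \<comment> \<open>The eigenvalue of h^2 times the discrete Laplacian on the same grid
      function.\<close>
    define \<nu> where "\<nu> = (of_real h)\<^sup>2 * \<mu> / (\<i> * of_real a)"
    have "(\<Sum>m<length N. of_real \<alpha> * neighbour_sum bc N m \<Psi> i - of_real \<beta> * \<Psi> i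
        - of_real \<gamma> * neighbour_sum bc N m (neighbour_sum bc N m \<Psi>) i) = \<nu> * \<Psi> i"
      if "i \<in> interior bc N" for i
    proof -
      have "(\<Sum>m<length N. of_real \<alpha> * neighbour_sum bc N m \<Psi> i - of_real \<beta> * \<Psi> i
          - of_real \<gamma> * neighbour_sum bc N m (neighbour_sum bc N m \<Psi>) i)
          = (of_real h)\<^sup>2 * discrete_laplacian S bc N h \<Psi> i"
        using \<open>h > 0\<close> by (simp add: lap[OF supp that])
      also have "\<dots> = \<nu> * \<Psi> i"
        using eig[OF that] \<open>a > 0\<close> by (simp add: \<nu>_def divide_simps) (simp add: mult_ac)
      finally show ?thesis .
    qed
    note bounds = eigenvalue_neighbour_polynomial[OF supp nz this]
    obtain l where l: "\<nu> = of_real l"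
      using bounds(1) by (auto elim: Reals_cases)
    define y where "y = k * a * l / h\<^sup>2"
    have "\<mu> = \<i> * of_real a * \<nu> / (of_real h)\<^sup>2"
      using \<open>a > 0\<close> \<open>h > 0\<close> by (simp add: \<nu>_def)
    then have y: "of_real k * \<mu> = \<i> * of_real y"
      by (simp add: l y_def)
    have "k * a * \<bar>l\<bar> \<le> k * a * (real (length N) * (2 * \<bar>\<alpha>\<bar> + \<bar>\<beta>\<bar> + 4 * \<bar>\<gamma>\<bar>))"
      using bounds(2) \<open>a > 0\<close> \<open>k > 0\<close> by (intro mult_left_mono) (auto simp: l)
    also note k
    finally have "\<bar>y\<bar> \<le> 2 * sqrt 2"
      using \<open>a > 0\<close> \<open>h > 0\<close> \<open>k > 0\<close> by (simp add: y_def abs_mult divide_le_eq)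
    then have "\<bar>y\<bar>\<^sup>2 \<le> (2 * sqrt 2)\<^sup>2"
      by (intro power_mono) auto
    then show ?thesis
      unfolding y by (intro norm_RK4_poly_imaginary) (simp add: power_mult_distrib)
  qed
qed

theorem mainTheorem1:
  fixes d :: nat and N :: "nat list" and bc :: boundary_condition and a h k :: real
  assumes "d \<in> {1, 2, 3}"
    and "length N = d" and "\<forall>m<d. 3 \<le> N ! m"
    and "a > 0" and "h > 0" and "k > 0"
  shows "(k < h\<^sup>2 / (real d * sqrt 2 * a) \<longrightarrow>
            RK4_stable (schroedinger_matrix CD bc N h a) k) \<and>
         (k < 3 / 4 * (h\<^sup>2 / (real d * sqrt 2 * a)) \<longrightarrow>
            RK4_stable (schroedinger_matrix TwoSHOC bc N h a) k)"
proof (intro conjI impI)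
  have pos: "real d * sqrt 2 * a > 0"
    using assms by auto
  have sqrt2: "sqrt 2 * (sqrt 2 * x) = 2 * x" for x :: real
    by (simp flip: mult.assoc)
  have three_quarters: "4 / 3 * x < y" if "x < 3 / 4 * y" for x y :: real
    using that by linarith
  {
    assume "k < h\<^sup>2 / (real d * sqrt 2 * a)"
    then have "k * (real d * sqrt 2 * a) < h\<^sup>2"
      using pos by (simp add: pos_less_divide_eq)
    \<comment> \<open>The factor 2 \<open>sqrt 2\<close> is the stability limit of RK4; with the
      \<open>sqrt 2\<close> already present it yields the 4 = 2 * 1 + 2 of the CD coefficients
      below.\<close>
    then have "k * (real d * sqrt 2 * a) * (2 * sqrt 2) \<le> h\<^sup>2 * (2 * sqrt 2)"
      by (intro mult_right_mono) auto
    also have "k * (real d * sqrt 2 * a) * (2 * sqrt 2) = k * a * (real d * 4)"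
      by (simp add: sqrt2 mult_ac)
    finally have "k * a * (real d * 4) \<le> 2 * sqrt 2 * h\<^sup>2"
      by (simp only: mult_ac)
    then show "RK4_stable (schroedinger_matrix CD bc N h a) k"
      using assms
      by (intro RK4_stable_schroedinger_matrix[where \<alpha> = 1 and \<beta> = 2 and \<gamma> = 0])
        (auto simp: central_diff_def neighbour_sum_def algebra_simps)
  next
    assume "k < 3 / 4 * (h\<^sup>2 / (real d * sqrt 2 * a))"
    \<comment> \<open>The factor 3/4 is the ratio of the spectral bounds: 2 * 16/12 + 28/12 + 4 *
      1/12 = 16/3 for 2SHOC against 4 for CD.\<close>
    then have "4 / 3 * k < h\<^sup>2 / (real d * sqrt 2 * a)"
      by (rule three_quarters)
    then have "4 / 3 * k * (real d * sqrt 2 * a) < h\<^sup>2"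
      using pos by (simp only: pos_less_divide_eq)
    then have "4 / 3 * k * (real d * sqrt 2 * a) * (2 * sqrt 2) \<le> h\<^sup>2 * (2 * sqrt 2)"
      by (intro mult_right_mono) auto
    also have "4 / 3 * k * (real d * sqrt 2 * a) * (2 * sqrt 2) = k * a * (real d * (16 / 3))"
      by (simp add: sqrt2 mult_ac)
    finally have "k * a * (real d * (16 / 3)) \<le> 2 * sqrt 2 * h\<^sup>2"
      by (simp only: mult_ac)
    moreover have "discrete_laplacian TwoSHOC bc N h \<Psi> i = 1 / (of_real h)\<^sup>2 *
        (\<Sum>m<length N. of_real (16 / 12) * neighbour_sum bc N m \<Psi> i - of_real (28 / 12) * \<Psi> i
           - of_real (1 / 12) * neighbour_sum bc N m (neighbour_sum bc N m \<Psi>) i)"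
      if "\<And>j. j \<notin> interior bc N \<Longrightarrow> \<Psi> j = 0" "i \<in> interior bc N" for \<Psi> i
    proof -
      have "1 / (of_real h)\<^sup>2 * (x / 12) = 1 / (12 * (of_real h)\<^sup>2) * x" for x :: complex
        by simp
      moreover have "(\<Sum>m<length N. of_real (16 / 12) * neighbour_sum bc N m \<Psi> i
            - of_real (28 / 12) * \<Psi> i
            - of_real (1 / 12) * neighbour_sum bc N m (neighbour_sum bc N m \<Psi>) i)
          = (\<Sum>m<length N. 16 * neighbour_sum bc N m \<Psi> i - 28 * \<Psi> i
            - neighbour_sum bc N m (neighbour_sum bc N m \<Psi>) i) / 12"
        unfolding sum_divide_distrib by (intro sum.cong refl) (simp add: field_simps)
      ultimately show ?thesis
        using two_shoc_neighbour_sum[OF that(2,1)] by (simp only: discrete_laplacian.simps)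
    qed
    ultimately show "RK4_stable (schroedinger_matrix TwoSHOC bc N h a) k"
      using assms
      by (intro RK4_stable_schroedinger_matrix[where \<alpha> = "16 / 12" and \<beta> = "28 / 12" and \<gamma> = "1 / 12"])
        auto
  }
qed

end
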